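(* Let $q\ge 2$ and let $I=(L^f(u))\subset S=k[x_1,\ldots,x_n]$ be the final squarefree lexsegment ideal generated in degree $q$ determined by the monomial $u=x_1x_{i_2}\cdots x_{i_q}$, $2\leq i_2<\ldots<i_q\leq n$, and assume $I\neq I_{n,q}$. Let $F=\{i_2,\ldots,i_q\}$. Then $I$ has the minimal primary decomposition $$I=\left(\bigcap_{\substack{G\subset[n],\ |G|=n-q+1\\ x_G\geq_{lex}x_{F^c}}}P_G\right)\cap\left(\bigcap_{\substack{G\subset[n]\setminus\{1\},\ |G|=n-q+1\\ x_{G\setminus\{\min(G)\}}\geq_{lex}x_{F^c\setminus\{1\}}}}P_G\right)\cap\left(\bigcap_{\substack{G\subset[n],\ |G|=n-q\\ x_{F^c\setminus\{1\}}>_{lex}x_G}}P_G\right).$$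
   Context: $k$ is a field, $S=k[x_1,\ldots,x_n]$, $[n]=\{1,\ldots,n\}$. Monomials are ordered lexicographically with $x_1>x_2>\cdots>x_n$. $\mathrm{Mon}_q^s(S)$ is the set of squarefree monomials of degree $q$ in $S$. For $u\in \mathrm{Mon}_q^s(S)$, $L^f(u)=\{w\in \mathrm{Mon}_q^s(S): u\geq_{lex} w\}$ is the final squarefree lexsegment set of $u$, and the ideal $(L^f(u))$ it generates is a final squarefree lexsegment ideal. $I_{n,q}$ is the ideal generated by all squarefree monomials of degree $q$ in $S$. For $A\subset[n]$: $x_A=\prod_{i\in A}x_i$, $P_A=(x_i: i\in A)$, $A^c=[n]\setminus A$, and $\min(A)$ is the smallest element of $A$. Minimal primary decomposition means the irredundant intersection of the minimal primes of the (squarefree, hence radical) ideal $I$. *)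

theory Defs
  imports "HOL-Library.Poly_Mapping" "HOL-Algebra.Ideal"
begin

text \<open>
  A monomial is its exponent vector \<^typ>\<open>nat \<Rightarrow>\<^sub>0 nat\<close>, and a polynomial is a finitely
  supported map from monomials to coefficients. The order that the library puts on
  \<^typ>\<open>nat \<Rightarrow>\<^sub>0 nat\<close> is the lexicographic order with
  \<open>x\<^sub>1 > x\<^sub>2 > \<dots> > x\<^sub>n\<close>; see \<open>monomial_less_iff\<close>.
\<close>

type_synonym monomial = "nat \<Rightarrow>\<^sub>0 nat"
type_synonym 'k mpoly = "monomial \<Rightarrow>\<^sub>0 'k"

lemma monomial_less_iff:
  fixes u w :: monomial
  shows "w < u \<longleftrightarrow>
    (\<exists>i. Poly_Mapping.lookup w i < Poly_Mapping.lookup u i \<and>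
      (\<forall>j<i. Poly_Mapping.lookup w j = Poly_Mapping.lookup u j))"
  by (simp add: less_poly_mapping.rep_eq less_fun_def)

definition mpoly_ring :: "nat \<Rightarrow> 'k::field mpoly ring"
  where "mpoly_ring n =
    \<lparr>carrier = {p. \<forall>m\<in>Poly_Mapping.keys p. Poly_Mapping.keys m \<subseteq> {1..n}},
     mult = (*), one = 1, zero = 0, add = (+)\<rparr>"

lemma cring_mpoly_ring: "cring (mpoly_ring n :: 'k::field mpoly ring)"
proof -
  let ?R = "mpoly_ring n :: 'k mpoly ring"
  have carr: "p \<in> carrier ?R \<longleftrightarrow>
      (\<forall>m\<in>Poly_Mapping.keys p. Poly_Mapping.keys m \<subseteq> {1..n})" for p
    by (simp add: mpoly_ring_def)
  have ops: "mult ?R = (*)" "one ?R = 1" "zero ?R = 0" "add ?R = (+)"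
    by (simp_all add: mpoly_ring_def)
  have zero: "0 \<in> carrier ?R" and one: "1 \<in> carrier ?R"
    by (simp_all add: carr)
  have uminus: "- p \<in> carrier ?R" if "p \<in> carrier ?R" for p
    using that by (simp add: carr)
  have add: "p + q \<in> carrier ?R" if "p \<in> carrier ?R" "q \<in> carrier ?R" for p q
    using that Poly_Mapping.keys_add[of p q] unfolding carr by (meson UnE subsetD)
  have mult: "p * q \<in> carrier ?R" if p: "p \<in> carrier ?R" and q: "q \<in> carrier ?R" for p q
    unfolding carr
  proof
    fix m assume "m \<in> Poly_Mapping.keys (p * q)"
    then obtain a b where m: "m = a + b" and "a \<in> Poly_Mapping.keys p" "b \<in> Poly_Mapping.keys q"
      using Poly_Mapping.keys_mult[of p q] by auto
    then have "Poly_Mapping.keys a \<union> Poly_Mapping.keys b \<subseteq> {1..n}"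
      using p q unfolding carr by simp
    then show "Poly_Mapping.keys m \<subseteq> {1..n}"
      using Poly_Mapping.keys_add[of a b] unfolding m by (rule order_trans[rotated])
  qed
  show ?thesis
  proof (rule cringI)
    show "abelian_group ?R"
    proof (rule abelian_groupI)
      fix x assume "x \<in> carrier ?R"
      then have "- x \<in> carrier ?R" "add ?R (- x) x = zero ?R"
        by (simp_all add: uminus ops)
      then show "\<exists>y\<in>carrier ?R. add ?R y x = zero ?R" ..
    qed (simp_all add: ops zero add ac_simps)
    show "Group.comm_monoid ?R"
      by (rule comm_monoidI) (simp_all add: ops one mult ac_simps)
  qed (simp add: ops distrib_right)
qed

definition var_prod :: "nat set \<Rightarrow> monomial"
  where "var_prod A = (\<Sum>i\<in>A. Poly_Mapping.single i 1)"

definition sqfree_monomials :: "nat \<Rightarrow> nat \<Rightarrow> monomial set"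
  where "sqfree_monomials n q =
    {w. Poly_Mapping.keys w \<subseteq> {1..n} \<and> (\<forall>i. Poly_Mapping.lookup w i \<le> 1) \<and>
      (\<Sum>i\<in>Poly_Mapping.keys w. Poly_Mapping.lookup w i) = q}"

definition final_lexsegment :: "nat \<Rightarrow> nat \<Rightarrow> monomial \<Rightarrow> monomial set"
  where "final_lexsegment n q u = {w \<in> sqfree_monomials n q. u \<ge> w}"

definition monomial_ideal :: "nat \<Rightarrow> monomial set \<Rightarrow> 'k::field mpoly set"
  where "monomial_ideal n M = Idl\<^bsub>mpoly_ring n\<^esub> ((\<lambda>w. Poly_Mapping.single w 1) ` M)"

definition var_ideal :: "nat \<Rightarrow> nat set \<Rightarrow> 'k::field mpoly set"
  where "var_ideal n A = monomial_ideal n ((\<lambda>i. Poly_Mapping.single i 1) ` A)"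

text \<open>The empty intersection is the whole ring.\<close>

definition ideal_Inter :: "('a, 'b) ring_scheme \<Rightarrow> 'i set \<Rightarrow> ('i \<Rightarrow> 'a set) \<Rightarrow> 'a set"
  where "ideal_Inter R J Q = {a \<in> carrier R. \<forall>j\<in>J. a \<in> Q j}"

definition minimal_prime :: "('a, 'b) ring_scheme \<Rightarrow> 'a set \<Rightarrow> 'a set \<Rightarrow> bool"
  where "minimal_prime R I P \<longleftrightarrow> primeideal P R \<and> I \<subseteq> P \<and>
    (\<forall>P'. primeideal P' R \<and> I \<subseteq> P' \<and> P' \<subseteq> P \<longrightarrow> P' = P)"

text \<open>
  For a radical ideal \<open>I\<close>, the minimal primary decomposition is the irredundant
  intersection of the minimal primes of \<open>I\<close>. Irredundancy is required of the indexed
  family, so distinct indices carry distinct primes.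
\<close>

definition minimal_primary_decomposition ::
    "('a, 'b) ring_scheme \<Rightarrow> 'a set \<Rightarrow> 'i set \<Rightarrow> ('i \<Rightarrow> 'a set) \<Rightarrow> bool"
  where "minimal_primary_decomposition R I J Q \<longleftrightarrow>
    finite J \<and> I = ideal_Inter R J Q \<and> Q ` J = {P. minimal_prime R I P} \<and>
    (\<forall>j\<in>J. ideal_Inter R (J - {j}) Q \<noteq> I)"

end

theory Submission
  imports Defs
begin

text \<open>
  A squarefree monomial ideal is the edge ideal of a hypergraph, and its minimal primes are the
  \<open>P\<^sub>C\<close> with \<open>C\<close> a minimal vertex cover. Here the edges are the \<open>q\<close>-subsets \<open>A\<close> of \<open>[n]\<close> with
  \<open>x\<^sub>A \<le> x\<^sub>1 x\<^sub>F\<close>. Every \<open>q\<close>-subset of \<open>{2..n}\<close> is an edge, and complementation in \<open>[n]\<close> reverses the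
  lexicographic order, so \<open>C\<close> is a cover iff \<open>|C| > n - q\<close>, or \<open>|C| = n - q\<close> and
  \<open>x\<^sub>C < x\<^sub>H\<close> where \<open>H = F\<^sup>c - {1}\<close>. Thus the covers of size \<open>n - q\<close> are minimal, and a cover of size
  \<open>n - q + 1\<close> is minimal iff \<open>x\<^bsub>C - {x}\<^esub> \<ge> x\<^sub>H\<close> for all \<open>x \<in> C\<close>, a condition that is most restrictive
  for \<open>x = min C\<close>. The two cases \<open>1 \<in> C\<close> and \<open>1 \<notin> C\<close> give the first two families.
\<close>

section \<open>Ideals generated by monomials\<close>

lemma mpoly_ring_simps [simp]:
  "p \<in> carrier (mpoly_ring n) \<longleftrightarrow> (\<forall>m\<in>Poly_Mapping.keys p. Poly_Mapping.keys m \<subseteq> {1..n})"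
  "mult (mpoly_ring n) = (*)" "one (mpoly_ring n) = 1"
  "zero (mpoly_ring n) = 0" "add (mpoly_ring n) = (+)"
  by (simp_all add: mpoly_ring_def)

lemma a_inv_mpoly_ring:
  assumes "p \<in> carrier (mpoly_ring n)"
  shows "\<ominus>\<^bsub>mpoly_ring n\<^esub> p = - p"
proof -
  interpret cring "mpoly_ring n :: 'a mpoly ring" by (rule cring_mpoly_ring)
  have "- p \<in> carrier (mpoly_ring n)" using assms by simp
  then show ?thesis using assms by (intro minus_equality) (auto simp del: mpoly_ring_simps(1))
qed

lemma keys_add_monomial:
  fixes a b :: monomial
  shows "Poly_Mapping.keys (a + b) = Poly_Mapping.keys a \<union> Poly_Mapping.keys b"
  by (auto simp: in_keys_iff lookup_add)

lemma poly_mapping_sum_singles: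
  fixes p :: "'a \<Rightarrow>\<^sub>0 'b::comm_monoid_add"
  shows "p = (\<Sum>m\<in>Poly_Mapping.keys p. Poly_Mapping.single m (Poly_Mapping.lookup p m))"
  by (rule poly_mapping_eqI) (auto simp: lookup_sum lookup_single when_def in_keys_iff)

text \<open>Membership is decided term by term. The right side absorbs products because every
  monomial of \<open>x * a\<close> is a monomial of \<open>x\<close> times one of \<open>a\<close>;
  conversely, each term of such a \<open>p\<close> is a multiple of a generator.\<close>

lemma monomial_ideal_eq:
  assumes M: "\<And>w. w \<in> M \<Longrightarrow> Poly_Mapping.keys w \<subseteq> {1..n}"
  shows "(monomial_ideal n M :: 'k::field mpoly set) =
    {p \<in> carrier (mpoly_ring n). \<forall>m\<in>Poly_Mapping.keys p. \<exists>w\<in>M. \<exists>d. m = w + d}" (is "_ = ?J")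
proof
  interpret cring "mpoly_ring n :: 'k mpoly ring" by (rule cring_mpoly_ring)
  let ?S = "(\<lambda>w. Poly_Mapping.single w 1) ` M :: 'k mpoly set"
  have mult: "x * a \<in> ?J" if a: "a \<in> ?J" and x: "x \<in> carrier (mpoly_ring n)" for a x :: "'k mpoly"
  proof -
    have "x * a \<in> carrier (mpoly_ring n)"
      using m_closed[of x a] a x by (simp del: mpoly_ring_simps(1))
    moreover have "\<exists>w\<in>M. \<exists>d. m = w + d" if "m \<in> Poly_Mapping.keys (x * a)" for m
    proof -
      obtain b c where "m = b + c" "c \<in> Poly_Mapping.keys a"
        using \<open>m \<in> _\<close> Poly_Mapping.keys_mult[of x a] by blast
      moreover obtain w d where "w \<in> M" "c = w + d" using a calculation(2) by blast
      ultimately have "m = w + (b + d)" by (simp add: ac_simps)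
      then show ?thesis using \<open>w \<in> M\<close> by blast
    qed
    ultimately show ?thesis by blast
  qed
  have "ideal ?J (mpoly_ring n)"
  proof (rule idealI)
    show "ring (mpoly_ring n :: 'k mpoly ring)" by (rule ring_axioms)
    show "subgroup ?J (add_monoid (mpoly_ring n))"
    proof (rule add.subgroupI)
      show "?J \<subseteq> carrier (mpoly_ring n)" by blast
      have "0 \<in> ?J" by simp
      then show "?J \<noteq> {}" by blast
      show "\<ominus>\<^bsub>mpoly_ring n\<^esub> a \<in> ?J" if "a \<in> ?J" for a
        using that a_inv_mpoly_ring[of a n] by simp
      show "a \<oplus>\<^bsub>mpoly_ring n\<^esub> b \<in> ?J" if "a \<in> ?J" "b \<in> ?J" for a b
        using that Poly_Mapping.keys_add[of a b] unfolding mpoly_ring_simps mem_Collect_eq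
        by (meson UnE subsetD)
    qed
    show "x \<otimes>\<^bsub>mpoly_ring n\<^esub> a \<in> ?J" if "a \<in> ?J" "x \<in> carrier (mpoly_ring n)" for a x
      using mult[OF that] by (simp del: mpoly_ring_simps(1))
    show "a \<otimes>\<^bsub>mpoly_ring n\<^esub> x \<in> ?J" if "a \<in> ?J" "x \<in> carrier (mpoly_ring n)" for a x
      using mult[OF that] by (simp add: mult.commute del: mpoly_ring_simps(1))
  qed
  moreover have "?S \<subseteq> ?J"
  proof
    fix s assume "s \<in> ?S"
    then obtain w where "w \<in> M" "s = Poly_Mapping.single w 1" by blast
    moreover have "\<exists>v\<in>M. \<exists>d. w = v + d"
      using \<open>w \<in> M\<close> by (intro bexI[of _ w] exI[of _ 0]) simp_all
    ultimately show "s \<in> ?J" using M by simp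
  qed
  ultimately show "monomial_ideal n M \<subseteq> ?J"
    unfolding monomial_ideal_def by (rule genideal_minimal)
  have S: "?S \<subseteq> carrier (mpoly_ring n)" using M by auto
  have I: "ideal (monomial_ideal n M :: 'k mpoly set) (mpoly_ring n)"
    unfolding monomial_ideal_def using S by (rule genideal_ideal)
  interpret I: ideal "monomial_ideal n M :: 'k mpoly set" "mpoly_ring n" by (rule I)
  show "?J \<subseteq> monomial_ideal n M"
  proof
    fix p assume p: "p \<in> ?J"
    have summand: "Poly_Mapping.single m (Poly_Mapping.lookup p m) \<in> monomial_ideal n M"
      if m: "m \<in> Poly_Mapping.keys p" for m
    proof -
      obtain w d where w: "w \<in> M" and d: "m = w + d" using p m by blast
      have "Poly_Mapping.keys d \<subseteq> {1..n}" using p m d by (force simp: keys_add_monomial)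
      then have "Poly_Mapping.single d (Poly_Mapping.lookup p m) \<in> carrier (mpoly_ring n)" by simp
      moreover have "Poly_Mapping.single w 1 \<in> (monomial_ideal n M :: 'k mpoly set)"
        unfolding monomial_ideal_def using genideal_self[OF S] w by blast
      ultimately have "Poly_Mapping.single d (Poly_Mapping.lookup p m) * Poly_Mapping.single w 1
          \<in> monomial_ideal n M"
        using I.I_l_closed[of "Poly_Mapping.single w 1" "Poly_Mapping.single d (Poly_Mapping.lookup p m)"]
        by (simp del: mpoly_ring_simps(1))
      then show ?thesis by (simp add: mult_single d add.commute)
    qed
    have sum: "sum f A \<in> monomial_ideal n M"
      if "finite A" "\<And>a. a \<in> A \<Longrightarrow> f a \<in> monomial_ideal n M" for A and f :: "monomial \<Rightarrow> 'k mpoly"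
      using that
    proof (induction A rule: finite_induct)
      case empty
      show ?case using additive_subgroup.zero_closed[OF I.is_additive_subgroup] by simp
    next
      case (insert a A)
      then show ?case using additive_subgroup.a_closed[OF I.is_additive_subgroup, of "f a" "sum f A"] by simp
    qed
    show "p \<in> monomial_ideal n M"
      by (subst poly_mapping_sum_singles) (intro sum summand, auto)
  qed
qed

section \<open>Squarefree monomials and ideals generated by variables\<close>

lemma lookup_var_prod:
  "finite A \<Longrightarrow> Poly_Mapping.lookup (var_prod A) i = (if i \<in> A then 1 else 0)"
  by (simp add: var_prod_def lookup_sum lookup_single when_def)

lemma keys_var_prod: "finite A \<Longrightarrow> Poly_Mapping.keys (var_prod A) = A"
  by (auto simp: in_keys_iff lookup_var_prod split: if_splits)

lemma var_prod_dvd_iff: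
  assumes "finite A"
  shows "(\<exists>d. m = var_prod A + d) \<longleftrightarrow> A \<subseteq> Poly_Mapping.keys m"
proof
  assume "\<exists>d. m = var_prod A + d"
  then show "A \<subseteq> Poly_Mapping.keys m" using assms by (auto simp: keys_add_monomial keys_var_prod)
next
  assume "A \<subseteq> Poly_Mapping.keys m"
  \<comment> \<open>The subtraction of exponents does not truncate: every exponent of
    \<open>m\<close> on \<open>A\<close> is at least 1.\<close>
  then have "m = var_prod A + (m - var_prod A)"
    by (intro poly_mapping_eqI)
      (auto simp: lookup_add lookup_minus lookup_var_prod[OF assms] in_keys_iff dest!: subsetD)
  then show "\<exists>d. m = var_prod A + d" ..
qed

text \<open>From here on only supports matter, because x_A divides a monomial as soon as its support
  contains \<open>A\<close>.\<close>

lemma sqfree_ideal_eq: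
  assumes "\<And>A. A \<in> E \<Longrightarrow> A \<subseteq> {1..n}"
  shows "(monomial_ideal n (var_prod ` E) :: 'k::field mpoly set) =
    {p \<in> carrier (mpoly_ring n). \<forall>m\<in>Poly_Mapping.keys p. \<exists>A\<in>E. A \<subseteq> Poly_Mapping.keys m}"
proof -
  have fin: "finite A" if "A \<in> E" for A using assms[OF that] finite_subset by blast
  show ?thesis
  proof (subst monomial_ideal_eq)
    show "Poly_Mapping.keys w \<subseteq> {1..n}" if "w \<in> var_prod ` E" for w
      using that assms fin keys_var_prod by force
  qed (simp add: fin var_prod_dvd_iff del: mpoly_ring_simps(1))
qed

lemma var_ideal_eq:
  assumes "A \<subseteq> {1..n}"
  shows "(var_ideal n A :: 'k::field mpoly set) =
    {p \<in> carrier (mpoly_ring n). \<forall>m\<in>Poly_Mapping.keys p. A \<inter> Poly_Mapping.keys m \<noteq> {}}"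
proof -
  have "(\<lambda>i. Poly_Mapping.single i 1) ` A = var_prod ` ((\<lambda>i. {i}) ` A)"
    by (simp add: image_image var_prod_def)
  moreover have "\<And>B. B \<in> (\<lambda>i. {i}) ` A \<Longrightarrow> B \<subseteq> {1..n}" using assms by auto
  ultimately show ?thesis
    unfolding var_ideal_def by (simp only: sqfree_ideal_eq) auto
qed

lemma var_prod_in_var_ideal_iff:
  assumes "A \<subseteq> {1..n}" "B \<subseteq> {1..n}"
  shows "Poly_Mapping.single (var_prod B) 1 \<in> (var_ideal n A :: 'k::field mpoly set) \<longleftrightarrow> A \<inter> B \<noteq> {}"
  using assms finite_subset[OF assms(2)] by (simp add: var_ideal_eq keys_var_prod)

text \<open>This transfers minimality between the primes P_C and the covers \<open>C\<close>; single
  variables serve as test elements.\<close>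

lemma var_ideal_subset_iff:
  assumes "A \<subseteq> {1..n}" "B \<subseteq> {1..n}"
  shows "(var_ideal n A :: 'k::field mpoly set) \<subseteq> var_ideal n B \<longleftrightarrow> A \<subseteq> B"
proof
  assume sub: "(var_ideal n A :: 'k mpoly set) \<subseteq> var_ideal n B"
  show "A \<subseteq> B"
  proof
    fix x assume x: "x \<in> A"
    then have "Poly_Mapping.single (var_prod {x}) 1 \<in> (var_ideal n A :: 'k mpoly set)"
      using assms by (subst var_prod_in_var_ideal_iff) auto
    then have "Poly_Mapping.single (var_prod {x}) 1 \<in> (var_ideal n B :: 'k mpoly set)"
      using sub by blast
    then show "x \<in> B" using assms x by (subst (asm) var_prod_in_var_ideal_iff) auto
  qed
next
  assume "A \<subseteq> B"
  then show "(var_ideal n A :: 'k mpoly set) \<subseteq> var_ideal n B"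
    unfolding var_ideal_eq[OF assms(1)] var_ideal_eq[OF assms(2)] by blast
qed

lemma ideal_monomial_ideal:
  assumes "\<And>w. w \<in> M \<Longrightarrow> Poly_Mapping.keys w \<subseteq> {1..n}"
  shows "ideal (monomial_ideal n M :: 'k::field mpoly set) (mpoly_ring n)"
proof -
  interpret cring "mpoly_ring n :: 'k mpoly ring" by (rule cring_mpoly_ring)
  show ?thesis unfolding monomial_ideal_def using assms by (intro genideal_ideal) auto
qed

text \<open>Modulo P_A every polynomial equals one free of the variables in \<open>A\<close>. If a
  product lies in P_A, so does the product of the free parts; being free as well, it is 0, and one
  free part vanishes.\<close>

lemma primeideal_var_ideal:
  assumes A: "A \<subseteq> {1..n}"
  shows "primeideal (var_ideal n A :: 'k::field mpoly set) (mpoly_ring n)"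
proof (rule primeidealI)
  show "cring (mpoly_ring n :: 'k mpoly ring)" by (rule cring_mpoly_ring)
  show ideal: "ideal (var_ideal n A :: 'k mpoly set) (mpoly_ring n)"
    unfolding var_ideal_def using A by (intro ideal_monomial_ideal) auto
  interpret P: ideal "var_ideal n A :: 'k mpoly set" "mpoly_ring n" by (rule ideal)
  have "1 \<in> carrier (mpoly_ring n)" "1 \<notin> (var_ideal n A :: 'k mpoly set)"
    by (simp_all add: var_ideal_eq[OF A])
  then show "carrier (mpoly_ring n) \<noteq> (var_ideal n A :: 'k mpoly set)" by blast
  let ?free = "\<lambda>p::'k mpoly. \<forall>m\<in>Poly_Mapping.keys p. A \<inter> Poly_Mapping.keys m = {}"
  have split: "\<exists>p0 p1. p = p0 + p1 \<and> p0 \<in> var_ideal n A \<and> p1 \<in> carrier (mpoly_ring n) \<and> ?free p1"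
    if p: "p \<in> carrier (mpoly_ring n)" for p :: "'k mpoly"
  proof -
    \<comment> \<open>\<open>part X\<close> collects the terms of \<open>p\<close> that involve a
      variable from \<open>A\<close>, and \<open>part (- X)\<close> the remaining ones.\<close>
    define part where "part = (\<lambda>X. \<Sum>m\<in>Poly_Mapping.keys p \<inter> X. Poly_Mapping.single m (Poly_Mapping.lookup p m))"
    define X where "X = {m :: monomial. A \<inter> Poly_Mapping.keys m \<noteq> {}}"
    have lookup: "Poly_Mapping.lookup (part Y) m = (if m \<in> Y then Poly_Mapping.lookup p m else 0)" for Y m
      by (auto simp: part_def lookup_sum lookup_single when_def in_keys_iff)
    have keys: "Poly_Mapping.keys (part Y) = Poly_Mapping.keys p \<inter> Y" for Y
      by (auto simp: in_keys_iff lookup split: if_splits)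
    have "p = part X + part (- X)"
      by (rule poly_mapping_eqI) (simp add: lookup_add lookup)
    moreover have "part X \<in> var_ideal n A" using p by (auto simp: var_ideal_eq[OF A] keys X_def)
    moreover have "part (- X) \<in> carrier (mpoly_ring n)" "?free (part (- X))"
      using p by (auto simp: keys X_def)
    ultimately show ?thesis by blast
  qed
  fix a b :: "'k mpoly"
  assume a: "a \<in> carrier (mpoly_ring n)" and b: "b \<in> carrier (mpoly_ring n)"
    and "a \<otimes>\<^bsub>mpoly_ring n\<^esub> b \<in> var_ideal n A"
  then have ab: "a * b \<in> var_ideal n A" by (simp del: mpoly_ring_simps(1))
  obtain a0 a1 where a01: "a = a0 + a1" "a0 \<in> var_ideal n A" "a1 \<in> carrier (mpoly_ring n)" "?free a1"
    using split[OF a] by blast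
  obtain b0 b1 where b01: "b = b0 + b1" "b0 \<in> var_ideal n A" "b1 \<in> carrier (mpoly_ring n)" "?free b1"
    using split[OF b] by blast
  \<comment> \<open>\<open>a * b\<close> differs from \<open>a1 * b1\<close> by
    \<open>a0 * b + a1 * b0\<close>, and both of these summands have a factor in P_A.\<close>
  have "a0 * b \<in> var_ideal n A" using P.I_r_closed[OF a01(2) b] by (simp del: mpoly_ring_simps(1))
  moreover have "a1 * b0 \<in> var_ideal n A"
    using P.I_l_closed[OF b01(2) a01(3)] by (simp del: mpoly_ring_simps(1))
  ultimately have "a0 * b + a1 * b0 \<in> var_ideal n A"
    using additive_subgroup.a_closed[OF P.is_additive_subgroup, of "a0 * b" "a1 * b0"] by (simp del: mpoly_ring_simps(1))
  then have "- (a0 * b + a1 * b0) \<in> var_ideal n A"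
    unfolding var_ideal_eq[OF A] mpoly_ring_simps mem_Collect_eq keys_minus .
  then have "a * b + - (a0 * b + a1 * b0) \<in> var_ideal n A"
    using additive_subgroup.a_closed[OF P.is_additive_subgroup ab, of "- (a0 * b + a1 * b0)"] by (simp only: mpoly_ring_simps)
  also have "a * b + - (a0 * b + a1 * b0) = a1 * b1"
    by (simp add: a01(1) b01(1) algebra_simps)
  finally have "\<forall>m\<in>Poly_Mapping.keys (a1 * b1). A \<inter> Poly_Mapping.keys m \<noteq> {}"
    by (simp add: var_ideal_eq[OF A])
  moreover have "?free (a1 * b1)"
  proof
    fix m assume "m \<in> Poly_Mapping.keys (a1 * b1)"
    then obtain s t where "m = s + t" "s \<in> Poly_Mapping.keys a1" "t \<in> Poly_Mapping.keys b1"
      using Poly_Mapping.keys_mult[of a1 b1] by blast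
    then show "A \<inter> Poly_Mapping.keys m = {}"
      using a01(4) b01(4) by (simp add: keys_add_monomial Int_Un_distrib)
  qed
  ultimately have "Poly_Mapping.keys (a1 * b1) = {}" by blast
  then have "a1 * b1 = 0" by simp
  \<comment> \<open>There are no zero divisors: monomials are linearly ordered compatibly with
    addition, and the coefficients form a field.\<close>
  then have "a1 = 0 \<or> b1 = 0" by simp
  then show "a \<in> var_ideal n A \<or> b \<in> var_ideal n A" using a01 b01 by auto
qed

section \<open>Vertex covers and minimal primes\<close>

definition vertex_cover :: "'a set \<Rightarrow> 'a set set \<Rightarrow> 'a set \<Rightarrow> bool"
  where "vertex_cover V E C \<longleftrightarrow> C \<subseteq> V \<and> (\<forall>A\<in>E. A \<inter> C \<noteq> {})"

definition minimal_vertex_cover :: "'a set \<Rightarrow> 'a set set \<Rightarrow> 'a set \<Rightarrow> bool"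
  where "minimal_vertex_cover V E C \<longleftrightarrow>
    vertex_cover V E C \<and> (\<forall>D. vertex_cover V E D \<and> D \<subseteq> C \<longrightarrow> D = C)"

lemma minimal_vertex_cover_subset: "minimal_vertex_cover V E C \<Longrightarrow> C \<subseteq> V"
  by (simp add: minimal_vertex_cover_def vertex_cover_def)

lemma vertex_cover_mono:
  assumes "vertex_cover V E D" "D \<subseteq> C" "C \<subseteq> V"
  shows "vertex_cover V E C"
proof -
  have "A \<inter> C \<noteq> {}" if "A \<inter> D \<noteq> {}" for A using that assms(2) by blast
  then show ?thesis using assms by (simp add: vertex_cover_def)
qed

lemma ex_minimal_vertex_cover:
  assumes "finite V" "vertex_cover V E C"
  shows "\<exists>D\<subseteq>C. minimal_vertex_cover V E D"
proof -
  have "{D. vertex_cover V E D} \<subseteq> Pow V" by (auto simp: vertex_cover_def)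
  then have "finite {D. vertex_cover V E D}" using assms(1) by (simp add: finite_subset)
  from finite_has_minimal2[OF this, of C] assms(2) show ?thesis
    unfolding minimal_vertex_cover_def by auto
qed

text \<open>Enlarging a cover gives a cover, so a proper subcover of \<open>C\<close> could be
  enlarged to some \<open>C - {x}\<close>; single deletions suffice.\<close>

lemma minimal_vertex_cover_iff_remove:
  "minimal_vertex_cover V E C \<longleftrightarrow>
    vertex_cover V E C \<and> (\<forall>x\<in>C. \<not> vertex_cover V E (C - {x}))"
proof (intro iffI conjI)
  assume C: "vertex_cover V E C \<and> (\<forall>x\<in>C. \<not> vertex_cover V E (C - {x}))"
  have "D = C" if "vertex_cover V E D" "D \<subseteq> C" for D
  proof (rule ccontr)
    assume "D \<noteq> C"
    then obtain x where "x \<in> C" "D \<subseteq> C - {x}" using \<open>D \<subseteq> C\<close> by blast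
    moreover have "C \<subseteq> V" using C by (simp add: vertex_cover_def)
    ultimately have "vertex_cover V E (C - {x})"
      using vertex_cover_mono[OF \<open>vertex_cover V E D\<close>] by blast
    with C \<open>x \<in> C\<close> show False by blast
  qed
  then show "minimal_vertex_cover V E C" using C by (simp add: minimal_vertex_cover_def)
qed (auto simp: minimal_vertex_cover_def)

section \<open>Minimal primes of an edge ideal\<close>

context
  fixes n :: nat and E :: "nat set set" and I :: "'k::field mpoly set"
  assumes edges: "\<And>A. A \<in> E \<Longrightarrow> A \<subseteq> {1..n}"
    and I: "I = monomial_ideal n (var_prod ` E)"
begin

lemma edge_ideal_eq:
  "I = {p \<in> carrier (mpoly_ring n). \<forall>m\<in>Poly_Mapping.keys p. \<exists>A\<in>E. A \<subseteq> Poly_Mapping.keys m}"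
  unfolding I by (rule sqfree_ideal_eq) (rule edges)

text \<open>The generator x_A lies in P_C exactly when \<open>A\<close> meets \<open>C\<close>, and
  every monomial occurring in \<open>I\<close> is divisible by some x_A.\<close>

lemma edge_ideal_subset_var_ideal_iff:
  assumes "C \<subseteq> {1..n}"
  shows "I \<subseteq> var_ideal n C \<longleftrightarrow> vertex_cover {1..n} E C"
proof
  assume sub: "I \<subseteq> var_ideal n C"
  have "A \<inter> C \<noteq> {}" if A: "A \<in> E" for A
  proof -
    have "finite A" using edges[OF A] finite_subset by blast
    then have "Poly_Mapping.single (var_prod A) 1 \<in> I"
      using A edges[OF A] by (auto simp: edge_ideal_eq keys_var_prod)
    then have "Poly_Mapping.single (var_prod A) 1 \<in> (var_ideal n C :: 'k mpoly set)"
      using sub by blast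
    then show ?thesis
      using assms edges[OF A] by (subst (asm) var_prod_in_var_ideal_iff) auto
  qed
  then show "vertex_cover {1..n} E C" using assms by (simp add: vertex_cover_def)
next
  assume "vertex_cover {1..n} E C"
  then have "C \<inter> B \<noteq> {}" if "\<exists>A\<in>E. A \<subseteq> B" for B
    using that unfolding vertex_cover_def by blast
  then show "I \<subseteq> var_ideal n C"
    unfolding edge_ideal_eq var_ideal_eq[OF assms] by (intro Collect_mono) simp
qed

text \<open>Take for \<open>C\<close> the indices of all variables in \<open>P\<close>: a prime
  containing x_A contains one of its variables. This reduces the search for minimal primes to ideals
  generated by variables.\<close>

lemma primeideal_contains_cover:
  assumes P: "primeideal P (mpoly_ring n)" and IP: "I \<subseteq> P"
  obtains C where "vertex_cover {1..n} E C" "var_ideal n C \<subseteq> P"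
proof -
  interpret P: primeideal P "mpoly_ring n" by (rule P)
  define C where "C = {i \<in> {1..n}. Poly_Mapping.single (Poly_Mapping.single i 1) 1 \<in> P}"
  \<comment> \<open>The induction splits off one variable at a time; in the base case the product is
    1, which a proper ideal cannot contain.\<close>
  have mem: "A \<inter> C \<noteq> {}"
    if "finite A" "A \<subseteq> {1..n}" "Poly_Mapping.single (var_prod A) 1 \<in> P" for A
    using that
  proof (induction A rule: finite_induct)
    case empty
    then have "one (mpoly_ring n) \<in> P" by (simp add: var_prod_def)
    then show ?case using P.one_imp_carrier P.I_notcarr by blast
  next
    case (insert i A)
    let ?x = "Poly_Mapping.single (Poly_Mapping.single i 1) 1 :: 'k mpoly"
    let ?y = "Poly_Mapping.single (var_prod A) 1 :: 'k mpoly"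
    have "Poly_Mapping.single (var_prod (insert i A)) 1 = ?x * ?y"
      using insert.hyps by (simp add: var_prod_def mult_single)
    then have "?x \<otimes>\<^bsub>mpoly_ring n\<^esub> ?y \<in> P" using insert.prems by simp
    moreover have "?x \<in> carrier (mpoly_ring n)" "?y \<in> carrier (mpoly_ring n)"
      using insert by (auto simp: keys_var_prod)
    ultimately have "?x \<in> P \<or> ?y \<in> P" by (intro P.I_prime)
    then show ?case using insert by (auto simp: C_def)
  qed
  have "A \<inter> C \<noteq> {}" if A: "A \<in> E" for A
  proof (rule mem)
    show fin: "finite A" using edges[OF A] finite_subset by blast
    show "A \<subseteq> {1..n}" by (rule edges[OF A])
    have "Poly_Mapping.single (var_prod A) 1 \<in> I"
      using A edges[OF A] fin by (auto simp: edge_ideal_eq keys_var_prod)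
    then show "Poly_Mapping.single (var_prod A) 1 \<in> P" using IP by blast
  qed
  then have "vertex_cover {1..n} E C" by (auto simp: vertex_cover_def C_def)
  moreover have "var_ideal n C \<subseteq> P"
    unfolding var_ideal_def monomial_ideal_def
    by (rule P.genideal_minimal[OF P.is_ideal]) (auto simp: C_def)
  ultimately show ?thesis by (rule that)
qed

text \<open>Every prime over \<open>I\<close> lies above P_C for some cover \<open>C\<close>, and
  inclusions among the P_C are inclusions among the \<open>C\<close>, so minimality carries over
  both ways.\<close>

lemma minimal_prime_edge_ideal_iff:
  "minimal_prime (mpoly_ring n) I P \<longleftrightarrow>
    (\<exists>C. minimal_vertex_cover {1..n} E C \<and> P = var_ideal n C)"
proof
  assume P: "minimal_prime (mpoly_ring n) I P"
  then obtain C where C: "vertex_cover {1..n} E C" and CP: "var_ideal n C \<subseteq> P"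
    unfolding minimal_prime_def using primeideal_contains_cover by metis
  \<comment> \<open>The case \<open>D = C\<close> identifies \<open>P\<close> with P_C; a smaller
    cover then yields the same prime and must equal \<open>C\<close>.\<close>
  have P_eq: "var_ideal n D = P" if D: "vertex_cover {1..n} E D" "D \<subseteq> C" for D
  proof -
    have sub: "D \<subseteq> {1..n}" "C \<subseteq> {1..n}" using C D by (auto simp: vertex_cover_def)
    have "var_ideal n D \<subseteq> P" using CP var_ideal_subset_iff[OF sub] D(2) by blast
    then show ?thesis
      using P D(1) primeideal_var_ideal[OF sub(1)] edge_ideal_subset_var_ideal_iff[OF sub(1)]
      unfolding minimal_prime_def by blast
  qed
  have "D = C" if D: "vertex_cover {1..n} E D" "D \<subseteq> C" for D
  proof -
    have sub: "D \<subseteq> {1..n}" "C \<subseteq> {1..n}" using C D by (auto simp: vertex_cover_def)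
    have "(var_ideal n C :: 'k mpoly set) \<subseteq> var_ideal n D" using P_eq[OF D] P_eq[OF C] by simp
    then show ?thesis using D(2) var_ideal_subset_iff[OF sub(2,1)] by blast
  qed
  then show "\<exists>C. minimal_vertex_cover {1..n} E C \<and> P = var_ideal n C"
    using C P_eq[OF C] unfolding minimal_vertex_cover_def by blast
next
  assume "\<exists>C. minimal_vertex_cover {1..n} E C \<and> P = var_ideal n C"
  then obtain C where C: "minimal_vertex_cover {1..n} E C" and P: "P = var_ideal n C" by blast
  have subC: "C \<subseteq> {1..n}" by (rule minimal_vertex_cover_subset[OF C])
  have "P' = P" if P': "primeideal P' (mpoly_ring n)" "I \<subseteq> P'" "P' \<subseteq> P" for P'
  proof -
    obtain D where D: "vertex_cover {1..n} E D" "var_ideal n D \<subseteq> P'"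
      using primeideal_contains_cover[OF P'(1,2)] .
    have subD: "D \<subseteq> {1..n}" using D(1) by (simp add: vertex_cover_def)
    have "(var_ideal n D :: 'k mpoly set) \<subseteq> var_ideal n C" using D(2) P'(3) P by blast
    then have "D = C"
      using C D(1) var_ideal_subset_iff[OF subD subC] unfolding minimal_vertex_cover_def by blast
    then show ?thesis using D(2) P'(3) P by blast
  qed
  moreover have "I \<subseteq> P"
    using C edge_ideal_subset_var_ideal_iff[OF subC] unfolding P minimal_vertex_cover_def by blast
  ultimately show "minimal_prime (mpoly_ring n) I P"
    using primeideal_var_ideal[OF subC] unfolding minimal_prime_def P by blast
qed

text \<open>If the support of a monomial contains no edge, its complement is a cover. A minimal
  cover inside that complement gives a P_C containing no polynomial in which the monomial
  occurs.\<close>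

lemma edge_ideal_eq_Inter:
  "I = ideal_Inter (mpoly_ring n) {C. minimal_vertex_cover {1..n} E C} (var_ideal n)"
proof
  have "I \<subseteq> carrier (mpoly_ring n)" unfolding edge_ideal_eq by blast
  moreover have "I \<subseteq> var_ideal n C" if "minimal_vertex_cover {1..n} E C" for C
    using that edge_ideal_subset_var_ideal_iff[OF minimal_vertex_cover_subset[OF that]]
    unfolding minimal_vertex_cover_def by blast
  ultimately show "I \<subseteq> ideal_Inter (mpoly_ring n) {C. minimal_vertex_cover {1..n} E C} (var_ideal n)"
    unfolding ideal_Inter_def by blast
  show "ideal_Inter (mpoly_ring n) {C. minimal_vertex_cover {1..n} E C} (var_ideal n) \<subseteq> I"
  proof
    fix p :: "'k mpoly"
    assume p: "p \<in> ideal_Inter (mpoly_ring n) {C. minimal_vertex_cover {1..n} E C} (var_ideal n)"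
    have "\<exists>A\<in>E. A \<subseteq> Poly_Mapping.keys m" if m: "m \<in> Poly_Mapping.keys p" for m
    proof (rule ccontr)
      assume "\<not> (\<exists>A\<in>E. A \<subseteq> Poly_Mapping.keys m)"
      then have "vertex_cover {1..n} E ({1..n} - Poly_Mapping.keys m)"
        using edges unfolding vertex_cover_def by blast
      then obtain C where C: "C \<subseteq> {1..n} - Poly_Mapping.keys m" "minimal_vertex_cover {1..n} E C"
        using ex_minimal_vertex_cover[OF finite_atLeastAtMost] by metis
      then have "p \<in> var_ideal n C" using p by (simp add: ideal_Inter_def del: mpoly_ring_simps(1))
      then show False
        using m C(1) unfolding var_ideal_eq[OF minimal_vertex_cover_subset[OF C(2)]] by blast
    qed
    then show "p \<in> I" using p unfolding edge_ideal_eq ideal_Inter_def by blast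
  qed
qed

lemma minimal_primary_decomposition_edge_ideal:
  "minimal_primary_decomposition (mpoly_ring n) I {C. minimal_vertex_cover {1..n} E C} (var_ideal n)"
  unfolding minimal_primary_decomposition_def
proof (intro conjI ballI)
  let ?J = "{C. minimal_vertex_cover {1..n} E C}"
  have "?J \<subseteq> Pow {1..n}" using minimal_vertex_cover_subset by blast
  then show "finite ?J" by (rule finite_subset) simp
  show "I = ideal_Inter (mpoly_ring n) ?J (var_ideal n)" by (rule edge_ideal_eq_Inter)
  show "var_ideal n ` ?J = {P. minimal_prime (mpoly_ring n) I P}"
    by (auto simp: minimal_prime_edge_ideal_iff)
  fix C assume "C \<in> ?J"
  then have C: "minimal_vertex_cover {1..n} E C" by simp
  \<comment> \<open>The witness of irredundancy: it avoids P_C, but lies in P_D for every other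
    minimal cover \<open>D\<close>, since \<open>D\<close> is not contained in
    \<open>C\<close>.\<close>
  let ?x = "Poly_Mapping.single (var_prod ({1..n} - C)) 1 :: 'k mpoly"
  have "?x \<in> var_ideal n D" if D: "minimal_vertex_cover {1..n} E D" "D \<noteq> C" for D
  proof -
    have "\<not> D \<subseteq> C" using C D unfolding minimal_vertex_cover_def by blast
    then show ?thesis
      using minimal_vertex_cover_subset[OF D(1)] by (subst var_prod_in_var_ideal_iff) auto
  qed
  moreover have "?x \<in> carrier (mpoly_ring n)" by (auto simp: keys_var_prod)
  ultimately have "?x \<in> ideal_Inter (mpoly_ring n) (?J - {C}) (var_ideal n)"
    by (simp add: ideal_Inter_def del: mpoly_ring_simps(1))
  moreover have "?x \<notin> var_ideal n C"
    using minimal_vertex_cover_subset[OF C] by (subst var_prod_in_var_ideal_iff) auto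
  then have "?x \<notin> I" using C by (subst edge_ideal_eq_Inter) (auto simp: ideal_Inter_def)
  ultimately show "ideal_Inter (mpoly_ring n) (?J - {C}) (var_ideal n) \<noteq> I" by blast
qed

end

section \<open>The lexicographic order on squarefree monomials\<close>

lemma var_prod_less_iff:
  assumes "finite A" "finite B"
  shows "var_prod A < var_prod B \<longleftrightarrow> (\<exists>i. i \<notin> A \<and> i \<in> B \<and> (\<forall>j<i. j \<in> A \<longleftrightarrow> j \<in> B))"
  unfolding monomial_less_iff lookup_var_prod[OF assms(1)] lookup_var_prod[OF assms(2)]
  by (auto split: if_splits)

text \<open>Complements first differ at the same index as the sets themselves, with membership
  reversed there.\<close>

lemma var_prod_Diff_less_iff:
  assumes "finite V" "A \<subseteq> V" "B \<subseteq> V"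
  shows "var_prod (V - A) < var_prod (V - B) \<longleftrightarrow> var_prod B < var_prod A"
proof -
  have "finite A" "finite B" using assms finite_subset by auto
  moreover have "(i \<notin> V - A \<and> i \<in> V - B \<and> (\<forall>j<i. j \<in> V - A \<longleftrightarrow> j \<in> V - B)) \<longleftrightarrow>
      (i \<notin> B \<and> i \<in> A \<and> (\<forall>j<i. j \<in> B \<longleftrightarrow> j \<in> A))" for i
    using assms(2,3) by blast
  ultimately show ?thesis using assms(1) by (simp only: var_prod_less_iff finite_Diff)
qed

lemma var_prod_insert_less_iff:
  assumes "finite A" "finite B" "x \<notin> A" "x \<notin> B"
  shows "var_prod (insert x A) < var_prod (insert x B) \<longleftrightarrow> var_prod A < var_prod B"
proof -
  have "(i \<notin> insert x A \<and> i \<in> insert x B \<and> (\<forall>j<i. j \<in> insert x A \<longleftrightarrow> j \<in> insert x B)) \<longleftrightarrow>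
      (i \<notin> A \<and> i \<in> B \<and> (\<forall>j<i. j \<in> A \<longleftrightarrow> j \<in> B))" for i
    using assms(3,4) by auto
  then show ?thesis using assms(1,2) by (simp only: var_prod_less_iff finite_insert)
qed

lemma var_prod_less_if_one_mem:
  assumes "A \<subseteq> {1..n}" "B \<subseteq> {1..n}" "1 \<notin> A" "1 \<in> B"
  shows "var_prod A < var_prod B"
proof -
  have "finite A" "finite B" using assms finite_subset by auto
  \<comment> \<open>The only \<open>j < 1\<close> is 0, which lies in neither set.\<close>
  moreover have "\<forall>j<1. j \<in> A \<longleftrightarrow> j \<in> B" using assms by fastforce
  ultimately show ?thesis using assms by (subst var_prod_less_iff) auto
qed

text \<open>The least index carries the largest variable, so deleting it leaves the smallest
  monomial. A lower bound for all deletions thus needs testing only at \<open>Min C\<close>.\<close>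

lemma var_prod_remove_Min_le:
  assumes "finite C" "x \<in> C"
  shows "var_prod (C - {Min C}) \<le> var_prod (C - {x})"
proof (cases "x = Min C")
  case False
  have "Min C \<in> C" "\<forall>j<Min C. j \<notin> C" using assms by (auto intro: Min_in dest: Min_le)
  then have "var_prod (C - {Min C}) < var_prod (C - {x})"
    using assms False by (subst var_prod_less_iff) (auto intro!: exI[of _ "Min C"])
  then show ?thesis by simp
qed simp

text \<open>With exponents at most 1 the degree is the size of the support, so lexsegments become
  families of sets.\<close>

lemma sqfree_monomials_eq:
  "sqfree_monomials n q = var_prod ` {A. A \<subseteq> {1..n} \<and> card A = q}"
proof
  show "var_prod ` {A. A \<subseteq> {1..n} \<and> card A = q} \<subseteq> sqfree_monomials n q"
  proof
    fix w assume "w \<in> var_prod ` {A. A \<subseteq> {1..n} \<and> card A = q}"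
    then obtain A where A: "A \<subseteq> {1..n}" "card A = q" "w = var_prod A" by blast
    then have "finite A" using finite_subset by blast
    then show "w \<in> sqfree_monomials n q"
      using A by (simp add: sqfree_monomials_def keys_var_prod lookup_var_prod)
  qed
  show "sqfree_monomials n q \<subseteq> var_prod ` {A. A \<subseteq> {1..n} \<and> card A = q}"
  proof
    fix w assume w: "w \<in> sqfree_monomials n q"
    have one: "Poly_Mapping.lookup w j = 1" if "j \<in> Poly_Mapping.keys w" for j
      using w that unfolding sqfree_monomials_def in_keys_iff
      by (metis (mono_tags, lifting) le_antisym less_one mem_Collect_eq not_le)
    then have "card (Poly_Mapping.keys w) = q"
      using w by (simp add: sqfree_monomials_def)
    moreover have "w = var_prod (Poly_Mapping.keys w)"
      using one by (intro poly_mapping_eqI) (auto simp: lookup_var_prod in_keys_iff)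
    ultimately show "w \<in> var_prod ` {A. A \<subseteq> {1..n} \<and> card A = q}"
      using w by (auto simp: sqfree_monomials_def)
  qed
qed

section \<open>Vertex covers of a final lexsegment\<close>

context
  fixes n q :: nat and F :: "nat set"
  assumes q: "q \<ge> 1" and F: "F \<subseteq> {2..n}" and card_F: "card F = q - 1"
begin

text \<open>The complement of the support \<open>insert 1 F\<close> of u, spelled so that the
  families of the theorem can later be folded.\<close>

private abbreviation (input) H :: "nat set" where "H \<equiv> {1..n} - F - {1}"

private abbreviation (input) E :: "nat set set"
  where "E \<equiv> {A. A \<subseteq> {1..n} \<and> card A = q \<and> var_prod A \<le> var_prod (insert 1 F)}"

text \<open>\<open>F\<close> takes \<open>q - 1\<close> of the \<open>n - 1\<close> indices in
  \<open>{2..n}\<close>. Hence \<open>n - q\<close> is a true difference.\<close>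

private lemma q_le_n: "q \<le> n" if "n \<ge> 1"
proof -
  have "card F \<le> card {2..n}" using F by (intro card_mono) auto
  then show ?thesis using card_F that by simp
qed

text \<open>The set \<open>C\<close> is a cover iff its complement \<open>?T\<close> contains no
  edge. If \<open>?T\<close> has fewer than \<open>q\<close> elements there is none; if it has
  exactly \<open>q\<close>, only \<open>?T\<close> itself can be one; if it has more, there always
  is one.\<close>

lemma vertex_cover_lexsegment_iff:
  assumes n: "n \<ge> 1" and C: "C \<subseteq> {1..n}"
  shows "vertex_cover {1..n} E C \<longleftrightarrow>
    card C \<ge> n - q + 1 \<or> card C = n - q \<and> var_prod C < var_prod H"
proof -
  have qn: "q \<le> n" using n by (rule q_le_n)
  let ?T = "{1..n} - C"
  have finC: "finite C" using C finite_subset by blast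
  have cardC: "card C \<le> n" using card_mono[OF _ C] by simp
  have cardT: "card ?T = n - card C" using C finC by (simp add: card_Diff_subset)
  have cover: "vertex_cover {1..n} E C \<longleftrightarrow> (\<forall>A\<in>E. \<not> A \<subseteq> ?T)"
    using C unfolding vertex_cover_def by blast
  consider "card C \<ge> n - q + 1" | "card C = n - q" | "card C < n - q" by linarith
  then show ?thesis
  proof cases
    case 1
    then have "card ?T < q" using cardT qn cardC q by linarith
    then have "\<not> A \<subseteq> ?T" if "A \<in> E" for A using that card_mono[of ?T A] by auto
    then show ?thesis using cover 1 by simp
  next
    case 2
    then have T: "card ?T = q" using cardT qn by simp
    then have eq: "A = ?T" if "A \<in> E" "A \<subseteq> ?T" for A
      using that card_subset_eq[of ?T A] by simp
    have "vertex_cover {1..n} E C \<longleftrightarrow> ?T \<notin> E" using cover eq by blast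
    also have "\<dots> \<longleftrightarrow> var_prod (insert 1 F) < var_prod ?T" using T by auto
    also have "\<dots> \<longleftrightarrow> var_prod ({1..n} - ?T) < var_prod ({1..n} - insert 1 F)"
      using F n by (subst var_prod_Diff_less_iff) auto
    also have "{1..n} - ?T = C" using C by blast
    also have "{1..n} - insert 1 F = H" by blast
    finally show ?thesis using 2 by simp
  next
    case 3
    then have "card ?T \<ge> q + 1" using cardT by linarith
    \<comment> \<open>Dropping 1 costs at most one element, and every \<open>q\<close>-subset
      without 1 is an edge.\<close>
    then have "card (?T - {1}) \<ge> q" by (auto simp: card_Diff_singleton_if)
    then obtain A where A: "A \<subseteq> ?T - {1}" "card A = q"
      using obtain_subset_with_card_n by metis
    then have "var_prod A < var_prod (insert 1 F)"
      using F n by (intro var_prod_less_if_one_mem[of _ n]) auto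
    then have "A \<in> E" using A by auto
    then have "\<not> vertex_cover {1..n} E C" using cover A by blast
    then show ?thesis using 3 by auto
  qed
qed

lemma minimal_vertex_cover_lexsegment_iff:
  assumes n: "n \<ge> 1"
  shows "minimal_vertex_cover {1..n} E C \<longleftrightarrow> C \<subseteq> {1..n} \<and>
    (card C = n - q \<and> var_prod C < var_prod H \<or>
     card C = n - q + 1 \<and> (\<forall>x\<in>C. var_prod H \<le> var_prod (C - {x})))"
proof (cases "C \<subseteq> {1..n}")
  case True
  then have finC: "finite C" using finite_subset by blast
  \<comment> \<open>Deleting \<open>x\<close> lowers the size by one, so both thresholds of the
    cover criterion rise by one.\<close>
  have remove: "vertex_cover {1..n} E (C - {x}) \<longleftrightarrow> card C \<ge> n - q + 2 \<or>
      card C = n - q + 1 \<and> var_prod (C - {x}) < var_prod H" if "x \<in> C" for x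
  proof -
    have sub: "C - {x} \<subseteq> {1..n}" using True by blast
    have "card C = Suc (card (C - {x}))" by (rule card.remove[OF finC that])
    then show ?thesis unfolding vertex_cover_lexsegment_iff[OF n sub] by auto
  qed
  have "(\<forall>x\<in>C. \<not> vertex_cover {1..n} E (C - {x})) \<longleftrightarrow> (\<forall>x\<in>C. \<not> (card C \<ge> n - q + 2 \<or>
      card C = n - q + 1 \<and> var_prod (C - {x}) < var_prod H))"
    using remove by blast
  \<comment> \<open>Nonemptiness keeps the condition on deletions from being vacuous; this rules out
    covers of size at least \<open>n - q + 2\<close>.\<close>
  moreover have "C \<noteq> {}" if "card C \<ge> n - q + 1" using that by auto
  ultimately show ?thesis
    unfolding minimal_vertex_cover_iff_remove vertex_cover_lexsegment_iff[OF n True]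
    using True by (auto simp: not_less)
next
  case False
  then show ?thesis using minimal_vertex_cover_subset by blast
qed

text \<open>Covers of size \<open>n - q + 1\<close> are split by whether they contain 1. If they do,
  deleting any other vertex leaves 1, which \<open>H\<close> lacks, so only the deletion of 1 is a
  real test; restoring 1 on both sides gives the comparison with F^c.\<close>

lemma minimal_vertex_covers_lexsegment:
  assumes n: "n \<ge> 1"
  shows "{C. minimal_vertex_cover {1..n} E C} =
    {G. G \<subseteq> {1..n} \<and> card G = n - q + 1 \<and> var_prod G \<ge> var_prod ({1..n} - F)} \<union>
    {G. G \<subseteq> {1..n} - {1} \<and> card G = n - q + 1 \<and> var_prod (G - {Min G}) \<ge> var_prod H} \<union>
    {G. G \<subseteq> {1..n} \<and> card G = n - q \<and> var_prod H > var_prod G}"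
proof -
  have insert_H: "insert 1 H = {1..n} - F" using F n by auto
  have with_one: "(\<forall>x\<in>C. var_prod H \<le> var_prod (C - {x})) \<longleftrightarrow> var_prod ({1..n} - F) \<le> var_prod C"
    if C: "C \<subseteq> {1..n}" "1 \<in> C" for C
  proof -
    have "finite C" using C finite_subset by blast
    have "var_prod H \<le> var_prod (C - {x})" if "x \<noteq> 1" for x
    proof -
      have "H \<subseteq> {1..n}" "C - {x} \<subseteq> {1..n}" "1 \<notin> H" "1 \<in> C - {x}" using C that by blast+
      then show ?thesis by (rule less_imp_le[OF var_prod_less_if_one_mem])
    qed
    then have "(\<forall>x\<in>C. var_prod H \<le> var_prod (C - {x})) \<longleftrightarrow> var_prod H \<le> var_prod (C - {1})"
      using C(2) by metis
    also have "\<dots> \<longleftrightarrow> var_prod (insert 1 H) \<le> var_prod (insert 1 (C - {1}))"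
      unfolding not_less[symmetric] using \<open>finite C\<close> by (subst var_prod_insert_less_iff) auto
    also have "insert 1 (C - {1}) = C" using C(2) by blast
    finally show ?thesis unfolding insert_H .
  qed
  have without_one: "(\<forall>x\<in>C. var_prod H \<le> var_prod (C - {x})) \<longleftrightarrow> var_prod H \<le> var_prod (C - {Min C})"
    if C: "C \<subseteq> {1..n}" "C \<noteq> {}" for C
  proof -
    have "finite C" using C finite_subset by blast
    then show ?thesis using C(2) var_prod_remove_Min_le[of C] Min_in[of C] by (meson order_trans)
  qed
  \<comment> \<open>F^c contains 1, so members of the first family do too; this separates it from
    covers without 1.\<close>
  have one_mem: "1 \<in> C" if "C \<subseteq> {1..n}" "var_prod ({1..n} - F) \<le> var_prod C" for C
  proof (rule ccontr)
    assume "1 \<notin> C"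
    then have "var_prod C < var_prod ({1..n} - F)"
      using that(1) F n by (intro var_prod_less_if_one_mem[of _ n]) auto
    then show False using that(2) by simp
  qed
  show ?thesis
  proof (rule Set.set_eqI)
    fix C :: "nat set"
    \<comment> \<open>A set of size \<open>n - q + 1\<close> is nonempty, so its \<open>Min\<close>
      is one of its elements.\<close>
    have ne: "C \<noteq> {}" if "card C = n - q + 1" using that by auto
    show "C \<in> {C. minimal_vertex_cover {1..n} E C} \<longleftrightarrow> C \<in>
      {G. G \<subseteq> {1..n} \<and> card G = n - q + 1 \<and> var_prod G \<ge> var_prod ({1..n} - F)} \<union>
      {G. G \<subseteq> {1..n} - {1} \<and> card G = n - q + 1 \<and> var_prod (G - {Min G}) \<ge> var_prod H} \<union>
      {G. G \<subseteq> {1..n} \<and> card G = n - q \<and> var_prod H > var_prod G}"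
    proof (cases "1 \<in> C")
      case True
      then show ?thesis
        unfolding mem_Collect_eq Un_iff minimal_vertex_cover_lexsegment_iff[OF n]
        using with_one[of C] by blast
    next
      case False
      then show ?thesis
        unfolding mem_Collect_eq Un_iff minimal_vertex_cover_lexsegment_iff[OF n]
        using without_one[of C] ne one_mem[of C] by blast
    qed
  qed
qed

end

section \<open>The three families of primes of the final lexsegment ideal\<close>

theorem theorem2p8:
  fixes n q :: nat and i :: "nat \<Rightarrow> nat" and u :: monomial and F :: "nat set"
    and I :: "'k::field mpoly set" and \<G>\<^sub>1 \<G>\<^sub>2 \<G>\<^sub>3 :: "nat set set"
  assumes "q \<ge> 2"
    and "\<forall>j\<in>{2..q}. 2 \<le> i j \<and> i j \<le> n"
    and "strict_mono_on {2..q} i"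
    and "u = Poly_Mapping.single 1 1 + (\<Sum>j\<in>{2..q}. Poly_Mapping.single (i j) 1)"
    and "I = monomial_ideal n (final_lexsegment n q u)"
    and "I \<noteq> monomial_ideal n (sqfree_monomials n q)"
    and "F = i ` {2..q}"
    and "\<G>\<^sub>1 = {G. G \<subseteq> {1..n} \<and> card G = n - q + 1 \<and>
                var_prod G \<ge> var_prod ({1..n} - F)}"
    and "\<G>\<^sub>2 = {G. G \<subseteq> {1..n} - {1} \<and> card G = n - q + 1 \<and>
                var_prod (G - {Min G}) \<ge> var_prod (({1..n} - F) - {1})}"
    and "\<G>\<^sub>3 = {G. G \<subseteq> {1..n} \<and> card G = n - q \<and>
                var_prod (({1..n} - F) - {1}) > var_prod G}"
  shows "I = ideal_Inter (mpoly_ring n) \<G>\<^sub>1 (var_ideal n)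
           \<inter> ideal_Inter (mpoly_ring n) \<G>\<^sub>2 (var_ideal n)
           \<inter> ideal_Inter (mpoly_ring n) \<G>\<^sub>3 (var_ideal n)
       \<and> \<G>\<^sub>1 \<inter> \<G>\<^sub>2 = {} \<and> \<G>\<^sub>1 \<inter> \<G>\<^sub>3 = {} \<and> \<G>\<^sub>2 \<inter> \<G>\<^sub>3 = {}
       \<and> minimal_primary_decomposition (mpoly_ring n) I (\<G>\<^sub>1 \<union> \<G>\<^sub>2 \<union> \<G>\<^sub>3) (var_ideal n)"
proof -
  \<comment> \<open>Distinctness of the indices gives both the size of \<open>F\<close> and the
    rewriting of the sum in u as \<open>var_prod F\<close>.\<close>
  have inj: "inj_on i {2..q}" using assms(3) by (rule strict_mono_on_imp_inj_on)
  have F: "F \<subseteq> {2..n}" using assms(2,7) by auto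
  have finF: "finite F" and card_F: "card F = q - 1"
    using inj assms(7) by (simp_all add: card_image)
  \<comment> \<open>The index 2 belongs to \<open>{2..q}\<close>, so \<open>2 \<le> i 2\<close> and
    \<open>i 2 \<le> n\<close>.\<close>
  have n: "n \<ge> 1" using assms(1,2) by force
  have "(\<Sum>j\<in>{2..q}. Poly_Mapping.single (i j) 1) = var_prod F"
    unfolding var_prod_def assms(7) using inj by (simp add: sum.reindex)
  then have u: "u = var_prod (insert 1 F)"
    using F finF unfolding assms(4) var_prod_def by (subst sum.insert) auto
  define E where "E = {A. A \<subseteq> {1..n} \<and> card A = q \<and> var_prod A \<le> var_prod (insert 1 F)}"
  have "final_lexsegment n q u = var_prod ` E"
    unfolding final_lexsegment_def sqfree_monomials_eq E_def u by blast
  then have I: "I = monomial_ideal n (var_prod ` E)" using assms(5) by simp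
  have edges: "\<And>A. A \<in> E \<Longrightarrow> A \<subseteq> {1..n}" by (simp add: E_def)
  have "q \<ge> 1" using assms(1) by simp
  note covers = minimal_vertex_covers_lexsegment[OF this F card_F n, folded E_def assms(8-10)]
  have decomp: "minimal_primary_decomposition (mpoly_ring n) I (\<G>\<^sub>1 \<union> \<G>\<^sub>2 \<union> \<G>\<^sub>3) (var_ideal n)"
    using minimal_primary_decomposition_edge_ideal[OF edges I] unfolding covers .
  then have "I = ideal_Inter (mpoly_ring n) (\<G>\<^sub>1 \<union> \<G>\<^sub>2 \<union> \<G>\<^sub>3) (var_ideal n)"
    by (simp only: minimal_primary_decomposition_def)
  also have "\<dots> = ideal_Inter (mpoly_ring n) \<G>\<^sub>1 (var_ideal n)
      \<inter> ideal_Inter (mpoly_ring n) \<G>\<^sub>2 (var_ideal n) \<inter> ideal_Inter (mpoly_ring n) \<G>\<^sub>3 (var_ideal n)"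
    unfolding ideal_Inter_def by blast
  finally have "I = \<dots>" .
  moreover have "\<G>\<^sub>1 \<inter> \<G>\<^sub>2 = {}"
  proof -
    have False if "G \<in> \<G>\<^sub>1" "G \<in> \<G>\<^sub>2" for G
    proof -
      \<comment> \<open>Members of the second family omit 1, whereas F^c contains it.\<close>
      have "var_prod G < var_prod ({1..n} - F)"
        using that F n unfolding assms(9) by (intro var_prod_less_if_one_mem[of _ n]) auto
      then show False using that(1) unfolding assms(8) by auto
    qed
    then show ?thesis by blast
  qed
  \<comment> \<open>The sizes \<open>n - q + 1\<close> and \<open>n - q\<close> differ.\<close>
  moreover have "\<G>\<^sub>1 \<inter> \<G>\<^sub>3 = {}" "\<G>\<^sub>2 \<inter> \<G>\<^sub>3 = {}" unfolding assms(8-10) by auto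
  ultimately show ?thesis using decomp by blast
qed

end
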